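(* Let $I=[0,1]$. Let $a\in(1,\infty)$ be an irrational number such that $a^k$ is irrational for every positive integer $k$, and let $b\in(0,1)$ be a rational number such that $\frac1a>b$. Let $$H_{a,b}=\Big\{(x,y)\in I\times I : y=ax,\ x\in\Big[\tfrac{b}{a^2},\tfrac1a\Big]\Big\}\cup\Big\{(x,y)\in I\times I : y=bx,\ x\in\Big[\tfrac1{a^2},1\Big]\Big\}.$$ Then $H_{a,b}$ is i-embedded into $I\times I$; that is, $\mathrm{ent}(H_{a,b})>0$ and no periodic point is generated by $H_{a,b}$.
   Context: A closed relation on a compact metric space $X$ is a closed subset $G\subseteq X\times X$. For a positive integer $m$, $\star_{i=1}^{m}G^{-1}=\{(x_1,\dots,x_{m+1})\in X^{m+1} : (x_{i+1},x_i)\in G \text{ for } i=1,\dots,m\}$, and $\star_{i=1}^{\infty}G^{-1}=\{(x_1,x_2,\dots)\in\prod_{i=1}^\infty X : (x_{i+1},x_i)\in G\text{ for all }i\ge1\}$. The shift map $\sigma$ on $\star_{i=1}^{\infty}G^{-1}$ is $\sigma(x_1,x_2,x_3,\dots)=(x_2,x_3,\dots)$. A periodic point generated by $G$ is a point $\mathbf x\in\star_{i=1}^{\infty}G^{-1}$ with $\sigma^n(\mathbf x)=\mathbf x$ for some positive integer $n$; no periodic point is generated by $G$ if there is no such $\mathbf x$. For an open cover $\alpha$ of $X$, $\alpha^{n}=\{A_1\times\dots\times A_n : A_j\in\alpha\}$, and for closed $K\subseteq X^n$, $N(K,\alpha^n)$ is the minimal cardinality of a subfamily of $\alpha^n$ whose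 union contains $K$. For $G\ne\emptyset$, $\mathrm{ent}(G,\alpha)=\lim_{m\to\infty}\frac{1}{m}\log N(\star_{i=1}^mG^{-1},\alpha^{m+1})$ (convention: $\log 0:=0$, relevant only if a Mahavier product is empty; the limit exists). The entropy is $\mathrm{ent}(G)=\sup_\alpha\mathrm{ent}(G,\alpha)\in[0,\infty]$ over all open covers $\alpha$ of $X$ if $G\neq\emptyset$, and $\mathrm{ent}(\emptyset)=0$. $G$ is i-embedded (irrationally embedded) into $X\times X$ if $\mathrm{ent}(G)>0$ and no periodic point is generated by $G$. *)

theory Defs
  imports "HOL-Analysis.Analysis"
begin

text \<open>The space is a subset \<open>X\<close> of a metric type, with the subspace topology. All
  coordinates are numbered from 0: the paper's \<open>x\<^sub>1, x\<^sub>2, \<dots>\<close> are \<open>x 0, x 1, \<dots>\<close>, and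
  \<open>X\<^sup>n\<close> is the set of extensional functions on \<open>{..<n}\<close>. The notions below are meant for
  closed relations on compact spaces.\<close>

definition closed_relation :: "'a::metric_space set \<Rightarrow> ('a \<times> 'a) set \<Rightarrow> bool" where
  "closed_relation X G \<longleftrightarrow> compact X \<and> closedin (top_of_set (X \<times> X)) G"

definition mahavier :: "'a::metric_space set \<Rightarrow> ('a \<times> 'a) set \<Rightarrow> nat \<Rightarrow> (nat \<Rightarrow> 'a) set" where
  "mahavier X G m = {x \<in> {..<m + 1} \<rightarrow>\<^sub>E X. \<forall>i<m. (x (i + 1), x i) \<in> G}"

definition mahavier_inf :: "'a::metric_space set \<Rightarrow> ('a \<times> 'a) set \<Rightarrow> (nat \<Rightarrow> 'a) set" where
  "mahavier_inf X G = {x \<in> UNIV \<rightarrow> X. \<forall>i. (x (i + 1), x i) \<in> G}"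

definition shift_map :: "(nat \<Rightarrow> 'a) \<Rightarrow> nat \<Rightarrow> 'a" where
  "shift_map x = (\<lambda>i. x (i + 1))"

definition periodic_point :: "'a::metric_space set \<Rightarrow> ('a \<times> 'a) set \<Rightarrow> (nat \<Rightarrow> 'a) \<Rightarrow> bool" where
  "periodic_point X G x \<longleftrightarrow> x \<in> mahavier_inf X G \<and> (\<exists>n>0. (shift_map ^^ n) x = x)"

definition open_cover :: "'a::metric_space set \<Rightarrow> 'a set set \<Rightarrow> bool" where
  "open_cover X \<alpha> \<longleftrightarrow> (\<forall>A\<in>\<alpha>. openin (top_of_set X) A) \<and> \<Union>\<alpha> = X"

definition cover_power :: "'a set set \<Rightarrow> nat \<Rightarrow> (nat \<Rightarrow> 'a) set set" where
  "cover_power \<alpha> n = {Pi\<^sub>E {..<n} A | A. \<forall>j<n. A j \<in> \<alpha>}"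

text \<open>Only finite subfamilies compete for the minimum, since \<open>card\<close> is 0 on infinite sets.
  One exists whenever \<open>K\<close> is a closed subset of \<open>X\<^sup>n\<close>, \<open>X\<close> is compact and \<open>\<C>\<close> is a power
  of an open cover of \<open>X\<close>.\<close>

definition min_cover :: "'b set \<Rightarrow> 'b set set \<Rightarrow> nat" where
  "min_cover K \<C> = (LEAST k. \<exists>F\<subseteq>\<C>. finite F \<and> card F = k \<and> K \<subseteq> \<Union>F)"

text \<open>The limit is a real number: the logarithms are subadditive up to a projection of
  cover elements, so it exists for every open cover of a compact space. The term for
  \<open>m = 0\<close> plays no role.\<close>

definition ent_cover :: "'a::metric_space set \<Rightarrow> ('a \<times> 'a) set \<Rightarrow> 'a set set \<Rightarrow> real" where
  "ent_cover X G \<alpha> =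
     lim (\<lambda>m. 1 / real m *
       (let N = min_cover (mahavier X G m) (cover_power \<alpha> (m + 1))
        in if N = 0 then 0 else ln (real N)))"

definition ent :: "'a::metric_space set \<Rightarrow> ('a \<times> 'a) set \<Rightarrow> ereal" where
  "ent X G = (if G = {} then 0 else SUP \<alpha>\<in>{\<alpha>. open_cover X \<alpha>}. ereal (ent_cover X G \<alpha>))"

definition i_embedded :: "'a::metric_space set \<Rightarrow> ('a \<times> 'a) set \<Rightarrow> bool" where
  "i_embedded X G \<longleftrightarrow> ent X G > 0 \<and> \<not> (\<exists>x. periodic_point X G x)"

definition H :: "real \<Rightarrow> real \<Rightarrow> (real \<times> real) set" where
  "H a b =
     {(x, y) \<in> {0..1} \<times> {0..1}. y = a * x \<and> x \<in> {b / a\<^sup>2..1 / a}} \<union>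
     {(x, y) \<in> {0..1} \<times> {0..1}. y = b * x \<and> x \<in> {1 / a\<^sup>2..1}}"

lemma closed_relation_H: "closed_relation {0..1} (H a b)"
proof -
  have *: "closed {(x, y) \<in> {0..1} \<times> {0..1}. y = c * x \<and> x \<in> {l..u}}" for c l u :: real
  proof -
    have "{(x, y) \<in> {0..1} \<times> {0..1}. y = c * x \<and> x \<in> {l..u}} =
        ({0..1} \<inter> {l..u}) \<times> {0..1} \<inter> {p. snd p = c * fst p}"
      by auto
    moreover have "closed {p :: real \<times> real. snd p = c * fst p}"
      by (intro closed_Collect_eq continuous_intros)
    ultimately show ?thesis
      by (metis closed_Int closed_Times closed_atLeastAtMost)
  qed
  have "closed (H a b)"
    unfolding H_def by (intro closed_Un *)
  moreover have "H a b \<subseteq> {0..1} \<times> {0..1}"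
    unfolding H_def by auto
  ultimately show ?thesis
    unfolding closed_relation_def by (simp add: closed_subset)
qed

end

theory Submission
  imports Defs
begin

text \<open>Read backwards, a point of a Mahavier product is a forward orbit that multiplies by \<open>a\<close> or
  by \<open>b\<close> at each step, and both branches live on positive numbers only. If an orbit closes up after
  \<open>n\<close> steps, its positive starting point cancels and \<open>a ^ k * b ^ l = 1\<close> with \<open>k + l = n > 0\<close>. Since
  \<open>b\<close> is rational and \<open>a ^ k\<close> is irrational for \<open>k > 0\<close>, this forces \<open>k = 0\<close>, which is impossible
  because \<open>b < 1\<close>. So there are no periodic points (\<open>no_periodic_point_H\<close>).

  For the entropy, let \<open>J = [b/a\<^sup>2, 1]\<close>; every point of \<open>J\<close> has a successor in \<open>J\<close>, so orbits in
  \<open>J\<close> can be continued forever. On the window \<open>W = [1/a\<^sup>2, 1/a]\<close> both branches are available; they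
  lead to \<open>[1/a, 1]\<close> and to \<open>[b/a\<^sup>2, b/a]\<close>, and no member of the open cover \<open>{[0, 1/a), (b/a, 1]}\<close>
  meets both of these. The ratio of the ends of the window is \<open>a\<close>, so repeated multiplication by
  \<open>a\<close> cannot jump over it, and an orbit in \<open>J\<close> can be brought into \<open>W\<close> within a number of steps that
  does not depend on its starting point. Hence the number of orbits that the cover tells apart doubles
  at least every \<open>L\<close> steps (\<open>many_orbits_H\<close>), and each of them needs its own member of a covering
  family (\<open>many_orbits_le_min_cover\<close>). So the entropy is at least \<open>ln 2 / L\<close> (\<open>ent_H_pos\<close>).

  The entropy relative to a cover is a limit, so its existence has to be established before
  it can be bounded from a subsequence: covering numbers are submultiplicative in the length
  (\<open>min_cover_mahavier_add_le\<close>), and Fekete's lemma (\<open>subadditive_convergent\<close>) applies to their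
  logarithms.\<close>

section \<open>Fekete's lemma\<close>

lemma subadditive_multiple_le:
  fixes u :: "nat \<Rightarrow> real"
  assumes sub: "\<And>m n. u (m + n) \<le> u m + u n"
  shows "u (q * n + r) \<le> real q * u n + u r"
proof (induction q)
  case (Suc q)
  have "u (Suc q * n + r) \<le> u n + u (q * n + r)"
    using sub[of n "q * n + r"] by (simp add: algebra_simps)
  with Suc show ?case by (simp add: algebra_simps)
qed simp

text \<open>The limit is the infimum of the quotients: if \<open>u n / n\<close> is close to it, division with remainder
  by \<open>n\<close> bounds every \<open>u m\<close> by \<open>(m div n) * u n\<close> plus a constant.\<close>

lemma subadditive_convergent:
  fixes u :: "nat \<Rightarrow> real"
  assumes sub: "\<And>m n. u (m + n) \<le> u m + u n"
    and nonneg: "\<And>n. 0 \<le> u n"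
  shows "convergent (\<lambda>m. u m / real m)"
proof -
  define l where "l = (INF n\<in>{1..}. u n / real n)"
  have bdd: "bdd_below ((\<lambda>n. u n / real n) ` {1..})"
    by (rule bdd_belowI[of _ 0]) (auto simp: nonneg)
  have "(\<lambda>m. u m / real m) \<longlonglongrightarrow> l"
  proof (rule LIMSEQ_I)
    fix e :: real assume "0 < e"
    then have "l < l + e / 2" by simp
    then obtain n where n: "n \<ge> 1" and close: "u n / real n < l + e / 2"
      unfolding l_def using bdd by (subst (asm) cINF_less_iff) auto
    define C where "C = (\<Sum>r<n. u r)"
    have C: "u r \<le> C" if "r < n" for r
      unfolding C_def using that by (intro member_le_sum) (auto simp: nonneg)
    obtain M where M: "C / (e / 2) < real M" using reals_Archimedean2 by blast
    have "norm (u m / real m - l) < e" if m: "m \<ge> max 1 M" for m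
    proof -
      have m0: "real m > 0" using m by simp
      have "u m \<le> real (m div n) * u n + u (m mod n)"
        using subadditive_multiple_le[of u "m div n" n "m mod n"] sub by simp
      also have "\<dots> \<le> real (m div n) * u n + C"
        using C[of "m mod n"] n by simp
      also have "real (m div n) * u n \<le> (real m / real n) * u n"
        by (intro mult_right_mono nonneg of_nat_div_le_of_nat)
      finally have "u m / real m \<le> (real m / real n * u n + C) / real m"
        using m0 by (simp add: divide_right_mono)
      also have "\<dots> = u n / real n + C / real m"
        using m0 by (simp add: field_simps)
      also have "C / real m < e / 2"
      proof -
        have "C < real M * (e / 2)" using M \<open>0 < e\<close> by (simp add: field_simps)
        also have "\<dots> \<le> real m * (e / 2)" using m \<open>0 < e\<close> by (intro mult_right_mono) auto
        finally show ?thesis using m0 by (simp add: field_simps)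
      qed
      finally have "u m / real m < l + e" using close by simp
      moreover have "l \<le> u m / real m"
        unfolding l_def using m by (intro cINF_lower bdd) auto
      ultimately show ?thesis by (simp add: abs_less_iff)
    qed
    then show "\<exists>no. \<forall>m\<ge>no. norm (u m / real m - l) < e" by blast
  qed
  then show ?thesis by (rule convergentI)
qed

section \<open>Covering numbers of Mahavier products\<close>

lemma min_cover_le:
  assumes "F \<subseteq> \<C>" "finite F" "K \<subseteq> \<Union>F"
  shows "min_cover K \<C> \<le> card F"
  unfolding min_cover_def by (rule Least_le) (rule exI[of _ F], simp add: assms)

lemma min_cover_attained:
  assumes "F \<subseteq> \<C>" "finite F" "K \<subseteq> \<Union>F"
  obtains F' where "F' \<subseteq> \<C>" "finite F'" "card F' = min_cover K \<C>" "K \<subseteq> \<Union>F'"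
proof -
  have "\<exists>F'\<subseteq>\<C>. finite F' \<and> card F' = min_cover K \<C> \<and> K \<subseteq> \<Union>F'"
    unfolding min_cover_def by (rule LeastI_ex) (use assms in blast)
  then show ?thesis using that by blast
qed

lemma finite_cover_power:
  assumes "finite \<alpha>"
  shows "finite (cover_power \<alpha> n)"
proof -
  have "cover_power \<alpha> n \<subseteq> Pi\<^sub>E {..<n} ` ({..<n} \<rightarrow>\<^sub>E \<alpha>)"
  proof
    fix B assume "B \<in> cover_power \<alpha> n"
    then obtain A where "B = Pi\<^sub>E {..<n} A" "\<forall>j<n. A j \<in> \<alpha>"
      unfolding cover_power_def by blast
    then have "B = Pi\<^sub>E {..<n} (restrict A {..<n})" "restrict A {..<n} \<in> {..<n} \<rightarrow>\<^sub>E \<alpha>"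
      by (auto intro!: PiE_cong)
    then show "B \<in> Pi\<^sub>E {..<n} ` ({..<n} \<rightarrow>\<^sub>E \<alpha>)" by blast
  qed
  moreover have "finite (Pi\<^sub>E {..<n} ` ({..<n} \<rightarrow>\<^sub>E \<alpha>))"
    using assms by (intro finite_imageI finite_PiE) auto
  ultimately show ?thesis by (rule finite_subset)
qed

lemma mahavier_subset_cover_power:
  assumes "\<Union>\<alpha> = X"
  shows "mahavier X G m \<subseteq> \<Union>(cover_power \<alpha> (m + 1))"
proof
  fix x assume "x \<in> mahavier X G m"
  then have x: "x \<in> {..<m + 1} \<rightarrow>\<^sub>E X" by (simp add: mahavier_def)
  then have "\<forall>i\<in>{..<m + 1}. \<exists>A\<in>\<alpha>. x i \<in> A" using assms by (auto simp: PiE_iff)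
  then obtain A where A: "\<forall>i\<in>{..<m + 1}. A i \<in> \<alpha> \<and> x i \<in> A i"
    by metis
  then have "x \<in> Pi\<^sub>E {..<m + 1} A" using x by (auto simp: PiE_iff)
  moreover have "Pi\<^sub>E {..<m + 1} A \<in> cover_power \<alpha> (m + 1)"
    using A unfolding cover_power_def by blast
  ultimately show "x \<in> \<Union>(cover_power \<alpha> (m + 1))" by blast
qed

text \<open>A point of length \<open>m + n\<close> splits into points of lengths \<open>m\<close> and \<open>n\<close> that share the coordinate \<open>m\<close>.
  A box around the first and a box around the second combine to a box around the whole once the
  second box forgets its factor at the shared coordinate.\<close>

lemma min_cover_mahavier_add_le:
  fixes X :: "'a::metric_space set" and G :: "('a \<times> 'a) set"
  assumes "finite \<alpha>" and cover: "\<Union>\<alpha> = X"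
  defines "N \<equiv> \<lambda>m. min_cover (mahavier X G m) (cover_power \<alpha> (m + 1))"
  shows "N (m + n) \<le> N m * N n"
proof -
  have attained: "\<exists>F\<subseteq>cover_power \<alpha> (k + 1). finite F \<and> card F = N k \<and> mahavier X G k \<subseteq> \<Union>F" for k
    using min_cover_attained[OF order_refl finite_cover_power[OF \<open>finite \<alpha>\<close>]
        mahavier_subset_cover_power[OF cover]] unfolding N_def by metis
  obtain F where F: "F \<subseteq> cover_power \<alpha> (m + 1)" "finite F" "card F = N m" "mahavier X G m \<subseteq> \<Union>F"
    using attained[of m] by blast
  obtain F' where F': "F' \<subseteq> cover_power \<alpha> (n + 1)" "finite F'" "card F' = N n" "mahavier X G n \<subseteq> \<Union>F'"
    using attained[of n] by blast
  have sides: "\<exists>A. \<forall>B\<in>E. B = Pi\<^sub>E {..<k} (A B) \<and> (\<forall>j<k. A B j \<in> \<alpha>)"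
    if "E \<subseteq> cover_power \<alpha> k" for E k
    by (rule bchoice) (use that in \<open>auto simp: cover_power_def\<close>)
  obtain A where A: "\<forall>B\<in>F. B = Pi\<^sub>E {..<m + 1} (A B) \<and> (\<forall>j<m + 1. A B j \<in> \<alpha>)"
    using sides[OF F(1)] ..
  obtain A' where A': "\<forall>B\<in>F'. B = Pi\<^sub>E {..<n + 1} (A' B) \<and> (\<forall>j<n + 1. A' B j \<in> \<alpha>)"
    using sides[OF F'(1)] ..
  define glue where
    "glue = (\<lambda>(B, B'). Pi\<^sub>E {..<m + n + 1} (\<lambda>i. if i \<le> m then A B i else A' B' (i - m)))"
  have "mahavier X G (m + n) \<subseteq> \<Union>(glue ` (F \<times> F'))"
  proof
    fix x assume "x \<in> mahavier X G (m + n)"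
    then have x: "x \<in> {..<m + n + 1} \<rightarrow>\<^sub>E X" "\<And>i. i < m + n \<Longrightarrow> (x (i + 1), x i) \<in> G"
      by (auto simp: mahavier_def)
    have "restrict x {..<m + 1} \<in> mahavier X G m"
      using x by (auto simp: mahavier_def PiE_iff)
    then obtain B where B: "B \<in> F" "restrict x {..<m + 1} \<in> B" using F(4) by blast
    have "restrict (\<lambda>i. x (m + i)) {..<n + 1} \<in> mahavier X G n"
      using x(1) x(2)[of "m + i" for i] by (auto simp: mahavier_def PiE_iff)
    then obtain B' where B': "B' \<in> F'" "restrict (\<lambda>i. x (m + i)) {..<n + 1} \<in> B'"
      using F'(4) by blast
    have first: "x i \<in> A B i" if "i \<le> m" for i
    proof -
      have "restrict x {..<m + 1} \<in> Pi\<^sub>E {..<m + 1} (A B)" using bspec[OF A B(1)] B(2) by simp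
      from PiE_mem[OF this, of i] show ?thesis using that by simp
    qed
    have second: "x (m + i) \<in> A' B' i" if "i \<le> n" for i
    proof -
      have "restrict (\<lambda>i. x (m + i)) {..<n + 1} \<in> Pi\<^sub>E {..<n + 1} (A' B')"
        using bspec[OF A' B'(1)] B'(2) by simp
      from PiE_mem[OF this, of i] show ?thesis using that by simp
    qed
    have "x i \<in> A' B' (i - m)" if "i < m + n + 1" "\<not> i \<le> m" for i
      using second[of "i - m"] that by simp
    then have "x \<in> glue (B, B')"
      using x(1) first by (auto simp: glue_def PiE_iff)
    then show "x \<in> \<Union>(glue ` (F \<times> F'))" using B(1) B'(1) by blast
  qed
  moreover have "glue ` (F \<times> F') \<subseteq> cover_power \<alpha> (m + n + 1)"
  proof
    fix P assume "P \<in> glue ` (F \<times> F')"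
    then obtain B B' where B: "B \<in> F" "B' \<in> F'" "P = glue (B, B')" by blast
    have "\<forall>j<m + n + 1. (if j \<le> m then A B j else A' B' (j - m)) \<in> \<alpha>"
      using bspec[OF A B(1)] bspec[OF A' B(2)] by simp
    then show "P \<in> cover_power \<alpha> (m + n + 1)"
      unfolding B(3) glue_def cover_power_def by auto
  qed
  ultimately have "N (m + n) \<le> card (glue ` (F \<times> F'))"
    unfolding N_def using F(2) F'(2) by (intro min_cover_le) auto
  also have "\<dots> \<le> card (F \<times> F')"
    by (intro card_image_le finite_cartesian_product F(2) F'(2))
  finally show ?thesis by (simp add: card_cartesian_product F(3) F'(3))
qed

text \<open>Since the defining limit exists, a lower bound along multiples of \<open>L\<close> is enough.\<close>

lemma ent_cover_ge:
  fixes X :: "'a::metric_space set"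
  assumes "finite \<alpha>" and cover: "\<Union>\<alpha> = X" and "L > 0"
    and pos: "\<And>m. min_cover (mahavier X G m) (cover_power \<alpha> (m + 1)) > 0"
    and growth: "\<And>k. 2 ^ k \<le> min_cover (mahavier X G (k * L)) (cover_power \<alpha> (k * L + 1))"
  shows "ln 2 / real L \<le> ent_cover X G \<alpha>"
proof -
  define N where "N = (\<lambda>m. min_cover (mahavier X G m) (cover_power \<alpha> (m + 1)))"
  define v where "v = (\<lambda>m. ln (real (N m)) / real m)"
  have N_pos: "N m > 0" for m using pos by (simp add: N_def)
  have "convergent v"
    unfolding v_def
  proof (rule subadditive_convergent)
    fix m n
    have "real (N (m + n)) \<le> real (N m) * real (N n)"
      using min_cover_mahavier_add_le[OF assms(1,2), of G m n]
      unfolding N_def of_nat_mult[symmetric] of_nat_le_iff .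
    then have "ln (real (N (m + n))) \<le> ln (real (N m) * real (N n))"
      using N_pos by simp
    then show "ln (real (N (m + n))) \<le> ln (real (N m)) + ln (real (N n))"
      using N_pos by (simp add: ln_mult)
  next
    fix m show "0 \<le> ln (real (N m))" using N_pos[of m] by simp
  qed
  then have "v \<longlonglongrightarrow> lim v" by (simp add: convergent_LIMSEQ_iff)
  moreover have "strict_mono (\<lambda>k. Suc k * L)"
    using \<open>L > 0\<close> by (auto simp: strict_mono_def)
  ultimately have "(\<lambda>k. v (Suc k * L)) \<longlonglongrightarrow> lim v"
    using LIMSEQ_subseq_LIMSEQ[of v "lim v" "\<lambda>k. Suc k * L"] by (simp add: o_def)
  moreover have "ln 2 / real L \<le> v (Suc k * L)" for k
  proof -
    have "2 ^ Suc k \<le> N (Suc k * L)" using growth[of "Suc k"] by (simp only: N_def)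
    then have "(2::real) ^ Suc k \<le> real (N (Suc k * L))"
      by (metis of_nat_le_iff of_nat_numeral of_nat_power)
    then have "ln ((2::real) ^ Suc k) \<le> ln (real (N (Suc k * L)))"
      using N_pos by (subst ln_le_cancel_iff) auto
    then have le: "real (Suc k) * ln 2 \<le> ln (real (N (Suc k * L)))"
      by (simp only: ln_realpow zero_less_numeral)
    have "ln 2 / real L = real (Suc k) * ln 2 / real (Suc k * L)"
      using \<open>L > 0\<close> unfolding of_nat_mult by (simp del: of_nat_Suc)
    also have "\<dots> \<le> v (Suc k * L)"
      unfolding v_def using le by (rule divide_right_mono) simp
    finally show ?thesis .
  qed
  ultimately have "ln 2 / real L \<le> lim v"
    by (intro LIMSEQ_le_const) auto
  moreover have "ent_cover X G \<alpha> = lim (\<lambda>m. 1 / real m * (if N m = 0 then 0 else ln (real (N m))))"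
    by (simp only: ent_cover_def N_def Let_def)
  moreover have "\<dots> = lim v"
    using N_pos by (simp add: v_def neq0_conv[symmetric] del: neq0_conv)
  ultimately show ?thesis by simp
qed

section \<open>Families of orbits that a cover tells apart\<close>

definition separated :: "'a set set \<Rightarrow> nat \<Rightarrow> (nat \<Rightarrow> 'a) \<Rightarrow> (nat \<Rightarrow> 'a) \<Rightarrow> bool" where
  "separated \<alpha> m x y \<longleftrightarrow> (\<exists>i\<le>m. \<forall>A\<in>\<alpha>. \<not> (x i \<in> A \<and> y i \<in> A))"

text \<open>In a Mahavier product the coordinate \<open>m\<close> is the first point of the forward orbit. Fixing it lets
  orbits be prolonged at that end by a single function update.\<close>

definition many_orbits ::
    "'a::metric_space set \<Rightarrow> ('a \<times> 'a) set \<Rightarrow> 'a set set \<Rightarrow> nat \<Rightarrow> 'a \<Rightarrow> nat \<Rightarrow> bool" where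
  "many_orbits X G \<alpha> m y n \<longleftrightarrow>
     (\<exists>S\<subseteq>mahavier X G m. finite S \<and> card S = n \<and> (\<forall>x\<in>S. x m = y) \<and> pairwise (separated \<alpha> m) S)"

text \<open>A box with sides in the cover contains at most one member of a separated family.\<close>

lemma many_orbits_le_min_cover:
  fixes X :: "'a::metric_space set"
  assumes "many_orbits X G \<alpha> m y n" "finite \<alpha>" "\<Union>\<alpha> = X"
  shows "n \<le> min_cover (mahavier X G m) (cover_power \<alpha> (m + 1))"
proof -
  obtain S where S: "S \<subseteq> mahavier X G m" "finite S" "card S = n" "pairwise (separated \<alpha> m) S"
    using assms(1) unfolding many_orbits_def by blast
  obtain F where F: "F \<subseteq> cover_power \<alpha> (m + 1)" "finite F" "mahavier X G m \<subseteq> \<Union>F"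
      "card F = min_cover (mahavier X G m) (cover_power \<alpha> (m + 1))"
    using min_cover_attained[OF order_refl finite_cover_power[OF assms(2)]
        mahavier_subset_cover_power[OF assms(3)]] by metis
  have "\<forall>x\<in>S. \<exists>B\<in>F. x \<in> B" using S(1) F(3) by blast
  then obtain f where f: "\<And>x. x \<in> S \<Longrightarrow> f x \<in> F \<and> x \<in> f x" by metis
  have "inj_on f S"
  proof (rule inj_onI)
    fix x x' assume *: "x \<in> S" "x' \<in> S" "f x = f x'"
    show "x = x'"
    proof (rule ccontr)
      assume "x \<noteq> x'"
      then have "separated \<alpha> m x x'" by (rule pairwiseD[OF S(4) *(1,2)])
      then obtain i where i: "i \<le> m" "\<forall>A\<in>\<alpha>. \<not> (x i \<in> A \<and> x' i \<in> A)"
        unfolding separated_def by blast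
      obtain A where A: "f x = Pi\<^sub>E {..<m + 1} A" "\<forall>j<m + 1. A j \<in> \<alpha>"
        using f[OF *(1)] F(1) unfolding cover_power_def by blast
      have "x i \<in> A i" "x' i \<in> A i"
        using f[OF *(1)] f[OF *(2)] *(3) A(1) i(1) PiE_mem[of _ "{..<m + 1}" A i] by auto
      then show False using i A(2) by auto
    qed
  qed
  then have "card S \<le> card F" using f F(2) by (intro card_inj_on_le[of f]) auto
  then show ?thesis using S(3) F(4) by simp
qed

lemma many_orbits_0:
  fixes X :: "'a::metric_space set"
  assumes "y \<in> X"
  shows "many_orbits X G \<alpha> 0 y 1"
proof -
  define x where "x = (\<lambda>i :: nat. if i = 0 then y else undefined)"
  have "x \<in> mahavier X G 0"
    using assms by (simp add: x_def mahavier_def PiE_iff extensional_def)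
  moreover have "x 0 = y" by (simp add: x_def)
  ultimately show ?thesis
    unfolding many_orbits_def by (intro exI[of _ "{x}"]) (simp add: pairwise_def)
qed

lemma many_orbits_prolong:
  fixes X :: "'a::metric_space set"
  assumes S: "S \<subseteq> mahavier X G m" "finite S" "pairwise (separated \<alpha> m) S"
    and y: "y \<in> X" "\<And>x. x \<in> S \<Longrightarrow> (y, x m) \<in> G"
  shows "many_orbits X G \<alpha> (m + 1) y (card S)"
proof -
  define p where "p = (\<lambda>x :: nat \<Rightarrow> 'a. x(m + 1 := y))"
  have "inj_on p S"
  proof (rule inj_onI)
    fix x x' assume *: "x \<in> S" "x' \<in> S" "p x = p x'"
    have "x i = x' i" for i
    proof (cases "i = m + 1")
      \<comment> \<open>Points of a Mahavier product are extensional, so nothing is overwritten.\<close>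
      case True
      have "z (m + 1) = undefined" if "z \<in> S" for z
        using that S(1) PiE_arb[of z "{..<m + 1}" "\<lambda>_. X" "m + 1"] by (auto simp: mahavier_def)
      from this[OF *(1)] this[OF *(2)] show ?thesis using True by simp
    next
      case False
      then show ?thesis using fun_cong[OF *(3), of i] by (simp add: p_def)
    qed
    then show "x = x'" by blast
  qed
  then have "card (p ` S) = card S" by (rule card_image)
  moreover have "p ` S \<subseteq> mahavier X G (m + 1)"
  proof
    fix z assume "z \<in> p ` S"
    then obtain x where x: "x \<in> S" "z = p x" by blast
    have "x \<in> mahavier X G m" using x(1) S(1) by blast
    then have "z \<in> {..<m + 1 + 1} \<rightarrow>\<^sub>E X"
      unfolding x(2) p_def using y(1) by (auto simp: mahavier_def PiE_iff extensional_def)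
    moreover have "(z (i + 1), z i) \<in> G" if "i < m + 1" for i
    proof (cases "i = m")
      case True
      then show ?thesis using y(2)[OF x(1)] by (simp add: x(2) p_def)
    next
      case False
      then show ?thesis using \<open>x \<in> mahavier X G m\<close> that by (simp add: x(2) p_def mahavier_def)
    qed
    ultimately show "z \<in> mahavier X G (m + 1)" by (simp add: mahavier_def)
  qed
  moreover have "pairwise (separated \<alpha> (m + 1)) (p ` S)"
  proof (rule pairwiseI)
    fix z z' assume "z \<in> p ` S" "z' \<in> p ` S" "z \<noteq> z'"
    then obtain x x' where x: "x \<in> S" "x' \<in> S" "x \<noteq> x'" "z = p x" "z' = p x'" by blast
    have "separated \<alpha> m x x'" by (rule pairwiseD[OF S(3) x(1-3)])
    then obtain i where "i \<le> m" "\<forall>A\<in>\<alpha>. \<not> (x i \<in> A \<and> x' i \<in> A)"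
      unfolding separated_def by blast
    then show "separated \<alpha> (m + 1) z z'"
      unfolding separated_def x(4,5) p_def by (intro exI[of _ i]) simp
  qed
  moreover have "\<forall>z\<in>p ` S. z (m + 1) = y" by (simp add: p_def)
  ultimately show ?thesis
    unfolding many_orbits_def using S(2) by (intro exI[of _ "p ` S"]) simp
qed

lemma many_orbits_step:
  fixes X :: "'a::metric_space set"
  assumes "many_orbits X G \<alpha> m y' n" "y \<in> X" "(y, y') \<in> G"
  shows "many_orbits X G \<alpha> (m + 1) y n"
proof -
  obtain S where S: "S \<subseteq> mahavier X G m" "finite S" "card S = n" "\<forall>x\<in>S. x m = y'"
      "pairwise (separated \<alpha> m) S"
    using assms(1) unfolding many_orbits_def by blast
  have "many_orbits X G \<alpha> (m + 1) y (card S)"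
    by (rule many_orbits_prolong) (use S assms in auto)
  then show ?thesis using S(3) by simp
qed

text \<open>A point whose two successors lie in no common member of the cover collects the families of both:
  orbits through different successors are separated right after the start.\<close>

lemma many_orbits_branch:
  fixes X :: "'a::metric_space set"
  assumes "many_orbits X G \<alpha> m y\<^sub>1 n\<^sub>1" "many_orbits X G \<alpha> m y\<^sub>2 n\<^sub>2"
    and "y \<in> X" "(y, y\<^sub>1) \<in> G" "(y, y\<^sub>2) \<in> G"
    and apart: "y\<^sub>1 \<noteq> y\<^sub>2" "\<forall>A\<in>\<alpha>. \<not> (y\<^sub>1 \<in> A \<and> y\<^sub>2 \<in> A)"
  shows "many_orbits X G \<alpha> (m + 1) y (n\<^sub>1 + n\<^sub>2)"
proof -
  obtain S\<^sub>1 where S1: "S\<^sub>1 \<subseteq> mahavier X G m" "finite S\<^sub>1" "card S\<^sub>1 = n\<^sub>1" "\<forall>x\<in>S\<^sub>1. x m = y\<^sub>1"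
      "pairwise (separated \<alpha> m) S\<^sub>1"
    using assms(1) unfolding many_orbits_def by blast
  obtain S\<^sub>2 where S2: "S\<^sub>2 \<subseteq> mahavier X G m" "finite S\<^sub>2" "card S\<^sub>2 = n\<^sub>2" "\<forall>x\<in>S\<^sub>2. x m = y\<^sub>2"
      "pairwise (separated \<alpha> m) S\<^sub>2"
    using assms(2) unfolding many_orbits_def by blast
  have cross: "separated \<alpha> m x x'" "separated \<alpha> m x' x" if "x \<in> S\<^sub>1" "x' \<in> S\<^sub>2" for x x'
    using that S1(4) S2(4) apart(2) unfolding separated_def by (auto intro!: exI[of _ m])
  have "pairwise (separated \<alpha> m) (S\<^sub>1 \<union> S\<^sub>2)"
    using S1(5) S2(5) cross unfolding pairwise_def by blast
  then have "many_orbits X G \<alpha> (m + 1) y (card (S\<^sub>1 \<union> S\<^sub>2))"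
    using S1 S2 assms(3-5) by (intro many_orbits_prolong) auto
  moreover have "S\<^sub>1 \<inter> S\<^sub>2 = {}" using S1(4) S2(4) apart(1) by auto
  ultimately show ?thesis using S1(2,3) S2(2,3) by (simp add: card_Un_disjoint)
qed

section \<open>Doubling in the two-branch relation\<close>

lemma H_branch_a:
  assumes "a > 1" "b > 0" "b / a\<^sup>2 \<le> z" "z \<le> 1 / a"
  shows "(z, a * z) \<in> H a b"
proof -
  have "0 < b / a\<^sup>2" using assms by simp
  then have "0 < z" using assms by linarith
  moreover have "a * z \<le> 1" using assms by (simp add: field_simps)
  moreover have "1 / a \<le> 1" using assms by simp
  ultimately have "z \<le> 1" "0 \<le> a * z" "a * z \<le> 1" using assms by (linarith, simp_all)
  then show ?thesis using assms \<open>0 < z\<close> by (simp add: H_def)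
qed

lemma H_branch_b:
  assumes "0 < b" "b < 1" "a > 1" "1 / a\<^sup>2 \<le> z" "z \<le> 1"
  shows "(z, b * z) \<in> H a b"
proof -
  have "0 < 1 / a\<^sup>2" using assms by simp
  then have "0 < z" using assms by linarith
  moreover have "b * z \<le> 1" using mult_mono[of b 1 z 1] assms \<open>0 < z\<close> by simp
  ultimately show ?thesis using assms by (auto simp: H_def)
qed

text \<open>An orbit from any point of \<open>[b/a\<^sup>2, 1]\<close> can be steered through the window \<open>[1/a\<^sup>2, 1/a]\<close> within \<open>L\<close> steps: a point above
  the window drops below its upper end under \<open>b\<close>, and a point below it climbs by factors \<open>a\<close> into it,
  starting from at least \<open>b/a\<^sup>2\<close>. Each passage doubles the family.\<close>

lemma many_orbits_H:
  fixes a b :: real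
  assumes a: "a > 1" and b: "0 < b" "b < 1" "b < 1 / a"
  defines "\<alpha> \<equiv> {{0..<1 / a}, {b / a<..1}}"
  shows "\<exists>L>0. \<forall>k. \<forall>y\<in>{b / a\<^sup>2..1}. many_orbits {0..1} (H a b) \<alpha> (k * L) y (2 ^ k)"
proof -
  define J where "J = {b / a\<^sup>2..1}"
  let ?P = "many_orbits {0..1} (H a b) \<alpha>"
  have a2: "0 < 1 / a\<^sup>2" "1 / a\<^sup>2 \<le> 1 / a" "1 / a < 1" "b / a\<^sup>2 < 1 / a\<^sup>2"
    using a b by (simp_all add: field_simps power2_eq_square)
  have bJ: "0 < b / a\<^sup>2" using a b by simp
  have J_unit: "z \<in> {0..1}" if "z \<in> J" for z using that bJ by (auto simp: J_def)
  have up: "a * z \<in> J" "(z, a * z) \<in> H a b" if "z \<in> J" "z \<le> 1 / a" for z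
  proof -
    have "z \<le> a * z" using a that bJ by (auto simp: J_def)
    moreover have "a * z \<le> 1" using that a by (simp add: field_simps)
    ultimately show "a * z \<in> J" using that by (simp add: J_def)
    show "(z, a * z) \<in> H a b"
      using H_branch_a[of a b z] a b that by (auto simp: J_def)
  qed
  have down: "b * z \<in> J" "(z, b * z) \<in> H a b" if "1 / a\<^sup>2 \<le> z" "z \<le> 1" for z
  proof -
    have "b / a\<^sup>2 \<le> b * z" using mult_left_mono[OF that(1), of b] b by simp
    moreover have "b * z \<le> 1" using mult_left_mono[OF that(2), of b] b by linarith
    ultimately show "b * z \<in> J" by (simp add: J_def)
    show "(z, b * z) \<in> H a b" using H_branch_b[of b a z] a b that by auto
  qed

  have pad1: "\<forall>z\<in>J. ?P (m + 1) z n" if "\<forall>z\<in>J. ?P m z n" for m n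
  proof
    fix z assume z: "z \<in> J"
    show "?P (m + 1) z n"
    proof (cases "z \<le> 1 / a")
      case True
      then show ?thesis using many_orbits_step[of "{0..1}" "H a b" \<alpha> m "a * z" n z]
        up[OF z] that J_unit[OF z] by blast
    next
      case False
      then have "1 / a\<^sup>2 \<le> z" "z \<le> 1" using a2 z by (auto simp: J_def)
      then show ?thesis using many_orbits_step[of "{0..1}" "H a b" \<alpha> m "b * z" n z]
        down[of z] that J_unit[OF z] by blast
    qed
  qed
  have pad: "\<forall>z\<in>J. ?P (m + j) z n" if "\<forall>z\<in>J. ?P m z n" for m n j
  proof (induction j)
    case (Suc j)
    then show ?case using pad1[of "m + j" n] by simp
  qed (use that in simp)

  have window: "?P (m + j + 1) z (2 * n)"
    if IH: "\<forall>z\<in>J. ?P m z n" and z: "1 / a\<^sup>2 \<le> z" "z \<le> 1 / a" for m n j z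
  proof -
    have zJ: "z \<in> J" "z \<le> 1" using z a2 by (auto simp: J_def)
    have lo: "1 / a \<le> a * z"
      using mult_left_mono[OF z(1), of a] a by (simp add: power2_eq_square)
    have hi: "b * z \<le> b / a"
      using mult_left_mono[OF z(2), of b] b by simp
    have "b / a < 1 / a" using a b by (simp add: divide_strict_right_mono)
    then have apart: "a * z \<noteq> b * z" "\<forall>A\<in>\<alpha>. \<not> (a * z \<in> A \<and> b * z \<in> A)"
      using lo hi by (auto simp: \<alpha>_def)
    have "?P (m + j + 1) z (n + n)"
      by (rule many_orbits_branch[where y\<^sub>1 = "a * z" and y\<^sub>2 = "b * z"])
        (use pad[OF IH] up zJ z down J_unit apart in blast)+
    then show ?thesis by (simp add: mult_2)
  qed

  \<comment> \<open>\<open>i\<close> bounds the climb to the window; \<open>j\<close> is a waiting time that makes all lengths equal.\<close>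
  have climb: "?P (m + i + j + 1) z (2 * n)"
    if IH: "\<forall>z\<in>J. ?P m z n" and z: "z \<in> J" "1 / a\<^sup>2 \<le> a ^ i * z" "z \<le> 1 / a" for m n i j z
    using z
  proof (induction i arbitrary: z)
    case 0
    then show ?case using window[OF IH, of z j] by simp
  next
    case (Suc i)
    show ?case
    proof (cases "1 / a\<^sup>2 \<le> z")
      case True
      then show ?thesis using window[OF IH, of z "Suc i + j"] Suc.prems by (simp add: add.assoc)
    next
      case False
      then have "a * z \<le> a * (1 / a\<^sup>2)" using a by (intro mult_left_mono) auto
      then have "a * z \<le> 1 / a" using a by (simp add: power2_eq_square)
      then have "?P (m + i + j + 1) (a * z) (2 * n)"
        using Suc.prems up[of z] by (intro Suc.IH) (auto simp: mult_ac)
      from many_orbits_step[OF this J_unit up(2)] Suc.prems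
      show ?thesis by simp
    qed
  qed

  obtain K where K: "1 / b < a ^ K" using real_arch_pow[OF a] by blast
  then have K1: "1 \<le> a ^ K * b" using b by (simp add: field_simps)
  have reach: "1 / a\<^sup>2 \<le> a ^ K * z" if "z \<in> J" for z
  proof -
    have "1 / a\<^sup>2 \<le> (a ^ K * b) / a\<^sup>2" using K1 by (intro divide_right_mono) auto
    also have "\<dots> = a ^ K * (b / a\<^sup>2)" by simp
    also have "\<dots> \<le> a ^ K * z" using that a by (intro mult_left_mono) (auto simp: J_def)
    finally show ?thesis .
  qed
  have double: "\<forall>z\<in>J. ?P (m + (K + 2)) z (2 * n)" if IH: "\<forall>z\<in>J. ?P m z n" for m n
  proof
    fix z assume z: "z \<in> J"
    show "?P (m + (K + 2)) z (2 * n)"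
    proof (cases "z \<le> 1 / a")
      case True
      then show ?thesis using climb[OF IH z reach[OF z], of 1] by simp
    next
      case False
      then have z': "1 / a\<^sup>2 \<le> z" "z \<le> 1" using a2 z by (auto simp: J_def)
      have "b * z \<le> b * 1" using z' b by (intro mult_left_mono) auto
      then have "b * z \<le> 1 / a" using b by linarith
      then have "?P (m + K + 0 + 1) (b * z) (2 * n)"
        using climb[OF IH _ reach] down(1)[OF z'] by blast
      from many_orbits_step[OF this J_unit[OF z] down(2)[OF z']]
      show ?thesis by simp
    qed
  qed
  have "\<forall>z\<in>J. ?P (k * (K + 2)) z (2 ^ k)" for k
  proof (induction k)
    case 0
    then show ?case using many_orbits_0[OF J_unit] by simp
  next
    case (Suc k)
    then show ?case using double[of "k * (K + 2)" "2 ^ k"] by (simp add: algebra_simps)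
  qed
  then show ?thesis unfolding J_def by (intro exI[of _ "K + 2"]) auto
qed

lemma ent_H_pos:
  fixes a b :: real
  assumes a: "a > 1" and b: "0 < b" "b < 1" "b < 1 / a"
  shows "ent {0..1} (H a b) > 0"
proof -
  define \<alpha> where "\<alpha> = {{0..<1 / a}, {b / a<..1}}"
  have ab: "b / a < 1 / a" "0 < b / a" "1 / a < 1"
    using a b by (simp_all add: divide_strict_right_mono)
  have cover: "\<Union>\<alpha> = {0..1}" using ab unfolding \<alpha>_def by auto
  have "openin (top_of_set {0..1}) {0..<1 / a}"
    unfolding openin_open by (rule exI[of _ "{..<1 / a}"]) (use ab in auto)
  moreover have "openin (top_of_set {0..1}) {b / a<..1}"
    unfolding openin_open by (rule exI[of _ "{b / a<..}"]) (use ab in auto)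
  ultimately have open_cov: "open_cover {0..1} \<alpha>"
    using cover unfolding open_cover_def \<alpha>_def by auto
  obtain L where "L > 0"
    and L: "\<And>k y. y \<in> {b / a\<^sup>2..1} \<Longrightarrow> many_orbits {0..1} (H a b) \<alpha> (k * L) y (2 ^ k)"
    using many_orbits_H[OF a b] unfolding \<alpha>_def by blast
  have fin: "finite \<alpha>" by (simp add: \<alpha>_def)
  have one: "1 \<in> {b / a\<^sup>2..1}" 
  proof -
    have "1 < a\<^sup>2" using a by simp
    then show ?thesis using b by (simp add: divide_le_eq)
  qed
  have growth: "2 ^ k \<le> min_cover (mahavier {0..1} (H a b) (k * L)) (cover_power \<alpha> (k * L + 1))" for k
    using many_orbits_le_min_cover[OF L[OF one] fin cover] .
  have pos: "min_cover (mahavier {0..1} (H a b) m) (cover_power \<alpha> (m + 1)) > 0" for m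
  proof -
    \<comment> \<open>Submultiplicativity turns a zero at \<open>m\<close> into a zero at the length \<open>m * L\<close>.\<close>
    let ?N = "\<lambda>m. min_cover (mahavier {0..1} (H a b) m) (cover_power \<alpha> (m + 1))"
    have "m + (m * L - m) = m * L" using \<open>L > 0\<close> by (simp add: Suc_leI)
    then have "?N (m * L) \<le> ?N m * ?N (m * L - m)"
      using min_cover_mahavier_add_le[OF fin cover, of "H a b" m "m * L - m"] by simp
    moreover have "0 < ?N (m * L)" using growth[of m] by (rule less_le_trans[rotated]) simp
    ultimately show ?thesis by (metis gr_zeroI mult_0 not_le)
  qed
  have "0 < ln 2 / real L" using \<open>L > 0\<close> by simp
  also have "\<dots> \<le> ent_cover {0..1} (H a b) \<alpha>"
    using ent_cover_ge[OF fin cover \<open>L > 0\<close> pos growth] .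
  finally have "0 < ereal (ent_cover {0..1} (H a b) \<alpha>)" by simp
  also have "\<dots> \<le> (SUP \<alpha>\<in>{\<alpha>. open_cover {0..1} \<alpha>}. ereal (ent_cover {0..1} (H a b) \<alpha>))"
    using open_cov by (intro SUP_upper) simp
  also have "\<dots> = ent {0..1} (H a b)"
  proof -
    have "(1, b * 1) \<in> H a b" using a b by (intro H_branch_b) auto
    then show ?thesis unfolding ent_def by auto
  qed
  finally show ?thesis .
qed

section \<open>Absence of periodic points\<close>

lemma shift_map_funpow: "(shift_map ^^ n) x i = x (i + n)"
  by (induction n arbitrary: i) (simp_all add: shift_map_def)

lemma no_periodic_point_H:
  fixes a b :: real
  assumes a: "a > 1" and irr: "\<And>k::nat. k > 0 \<Longrightarrow> a ^ k \<notin> \<rat>"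
    and b: "0 < b" "b < 1" "b \<in> \<rat>"
  shows "\<not> periodic_point {0..1} (H a b) x"
proof
  assume "periodic_point {0..1} (H a b) x"
  then obtain n where x: "\<And>i. (x (i + 1), x i) \<in> H a b" and n: "n > 0" "(shift_map ^^ n) x = x"
    unfolding periodic_point_def mahavier_inf_def by auto
  have "0 < b / a\<^sup>2" "0 < 1 / a\<^sup>2" using a b by simp_all
  then have step: "(x i = a * x (i + 1) \<or> x i = b * x (i + 1)) \<and> 0 < x (i + 1)" for i
    using x[of i] unfolding H_def by (auto dest: less_le_trans simp del: zero_less_divide_iff)
  have "\<exists>k l. k + l = m \<and> x 0 = a ^ k * b ^ l * x m" for m
  proof (induction m)
    case (Suc m)
    then obtain k l where kl: "k + l = m" "x 0 = a ^ k * b ^ l * x m" by blast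
    from step[of m] consider "x m = a * x (m + 1)" | "x m = b * x (m + 1)" by blast
    then show ?case
    proof cases
      case 1
      then show ?thesis using kl by (intro exI[of _ "Suc k"] exI[of _ l]) simp
    next
      case 2
      then show ?thesis using kl by (intro exI[of _ k] exI[of _ "Suc l"]) simp
    qed
  qed simp
  then obtain k l where kl: "k + l = n" "x 0 = a ^ k * b ^ l * x n" by blast
  have "x n = x 0" using fun_cong[OF n(2), of 0] by (simp add: shift_map_funpow)
  moreover have "0 < x n" using step[of "n - 1"] n(1) by simp
  ultimately have unit: "a ^ k * b ^ l = 1" using kl(2) by simp
  show False
  proof (cases "k = 0")
    case True
    then have "b ^ l < 1" using kl(1) n(1) b by (simp add: power_less_one_iff)
    then show False using unit True by simp
  next
    case False
    have "a ^ k = 1 / b ^ l" using unit b by (simp add: field_simps)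
    also have "\<dots> \<in> \<rat>" using b(3) by simp
    finally show False using irr False by blast
  qed
qed

theorem theorem7p1:
  fixes a b :: real
  assumes "a > 1"
    and "a \<notin> \<rat>"
    and "\<And>k::nat. k > 0 \<Longrightarrow> a ^ k \<notin> \<rat>"
    and "b \<in> {0<..<1}"
    and "b \<in> \<rat>"
    and "1 / a > b"
  shows "i_embedded {0..1} (H a b)"
proof -
  have b: "0 < b" "b < 1" using assms(4) by simp_all
  have "ent {0..1} (H a b) > 0"
    by (rule ent_H_pos[OF assms(1) b assms(6)])
  moreover have "\<not> periodic_point {0..1} (H a b) x" for x
    by (rule no_periodic_point_H[OF assms(1,3) b assms(5)])
  ultimately show ?thesis unfolding i_embedded_def by blast
qed

end
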